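(* Let $N=4$ and let $d$ be the design that selects each of the four assignment vectors in $\mathcal{W}=\{(1,1,0,0)^\top,(0,0,1,1)^\top,(1,0,0,1)^\top,(0,1,1,0)^\top\}$ with probability $1/4$. Let $$\hat V_{\text{sub}} = \frac{4}{N^2}\sum_{\bm{w}\in\mathcal{W}:\ \bm{W}\in\mathcal{G}^*(\bm{w})}\frac{p_{\bm{w}}}{p_{\bm{W}}}\,\frac{1}{|\mathcal{G}^*(\bm{w})|}\,\{\bm{l}(\bm{w})^\top\bm{Y}^{\text{obs}}\}^2$$ be the variance estimator of the contrast approach with the full sets of substitutes $\mathcal{G}^*(\bm{w})$. Then $\hat V_{\text{sub}}$ is identical to the Neymanian decomposition-based estimator (the Horvitz–Thompson-type estimator of $\tilde V_d(\bm{Q})$) with $$\bm{Q}=\frac1{16}\begin{pmatrix}1&-1&1&-1\\-1&1&-1&1\\1&-1&1&-1\\-1&1&-1&1\end{pmatrix}.$$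
   Context: There are $N$ units with fixed real potential outcomes $Y_i(0),Y_i(1)$; $\bm{W}\in\{0,1\}^N$ is the random assignment with $p_{\bm{w}}=\Pr_d(\bm{W}=\bm{w})$, support $\mathcal{W}$, $\pi_i=\Pr_d(W_i=1)$, $p_{ii'}(w,w')=\Pr_d(W_i=w,W_{i'}=w')$, and $Y_i^{\text{obs}}=W_iY_i(1)+(1-W_i)Y_i(0)$. Contrast approach: a substitute of $\bm{w}\in\mathcal{W}$ is a vector $\tilde{\bm{w}}\in\mathcal{W}$ whose treated set consists of exactly $N/4$ of the units treated under $\bm{w}$ and exactly $N/4$ of the units that are control under $\bm{w}$; $\mathcal{G}^*(\bm{w})$ is the set of all substitutes of $\bm{w}$; $l_i(\bm{w})=1$ if $w_i=1$ and $-1$ if $w_i=0$. Neymanian decomposition: for an $N\times N$ matrix $\bm{Q}=(q_{ii'})$ that is non-negative definite, has $q_{ii}=1/N^2$ for all $i$ and zero row sums, define $$\tilde V_d(\bm{Q})=\frac1{N^2}\Big\{\sum_i\frac{Y_i^2(1)}{\pi_i}+\sum_i\frac{Y_i^2(0)}{1-\pi_i}\Big\}+2\sum_{i<i'}\Big[Y_i(1)Y_{i'}(1)\Big\{\tfrac{p_{ii'}(1,1)}{N^2\pi_i\pi_{i'}}+q_{ii'}-\tfrac1{N^2}\Big\}+Y_i(0)Y_{i'}(0)\Big\{\tfrac{p_{ii'}(0,0)}{N^2(1-\pi_i)(1-\pi_{i'})}+q_{ii'}-\tfrac1{N^2}\Big\}\Big]$$ $$-2\sum_{i<i'}\Big[Y_i(1)Y_{i'}(0)\Big\{\tfrac{p_{ii'}(1,0)}{N^2\pi_i(1-\pi_{i'})}+q_{ii'}-\tfrac1{N^2}\Big\}+Y_i(0)Y_{i'}(1)\Big\{\tfrac{p_{ii'}(0,1)}{N^2(1-\pi_i)\pi_{i'}}+q_{ii'}-\tfrac1{N^2}\Big\}\Big].$$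 The Neymanian decomposition-based estimator replaces, in $\tilde V_d(\bm{Q})$, each $Y_i(w)^2$ by $\mathbb{1}(W_i=w)(Y_i^{\text{obs}})^2/\Pr_d(W_i=w)$ and each product $Y_i(w)Y_{i'}(w')$ ($i<i'$) having a nonzero coefficient by $\mathbb{1}(W_i=w,W_{i'}=w')Y_i^{\text{obs}}Y_{i'}^{\text{obs}}/p_{ii'}(w,w')$; terms with coefficient zero are omitted. *)

theory Defs
  imports "HOL-Probability.Probability_Mass_Function" "Jordan_Normal_Form.Matrix"
begin

(* Both libraries claim the infix for vector components; here it is the one of carrier_vec. *)
unbundle no vec_syntax

text \<open>
  There are \<open>N\<close> units, numbered \<open>0, \<dots>, N - 1\<close> in agreement with the vector and matrix indices.
  An assignment is a vector over \<open>nat\<close> of dimension \<open>N\<close> with entries \<open>0\<close> (control) and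
  \<open>1\<close> (treated); a design is a probability mass function on assignments.
  The potential outcome of unit \<open>i\<close> under arm \<open>w\<close> is \<open>Y i w\<close>, where only
  \<open>i < N\<close> and \<open>w \<in> {0, 1}\<close> matter.
\<close>

definition incl_prob :: "nat vec pmf \<Rightarrow> nat \<Rightarrow> real" where
  "incl_prob d i = measure_pmf.prob d {W. W $ i = 1}"

definition arm_prob :: "nat vec pmf \<Rightarrow> nat \<Rightarrow> nat \<Rightarrow> real" where
  "arm_prob d i w = measure_pmf.prob d {W. W $ i = w}"

definition joint_prob :: "nat vec pmf \<Rightarrow> nat \<Rightarrow> nat \<Rightarrow> nat \<Rightarrow> nat \<Rightarrow> real" where
  "joint_prob d i i' w w' = measure_pmf.prob d {W. W $ i = w \<and> W $ i' = w'}"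

definition Y_obs :: "nat \<Rightarrow> (nat \<Rightarrow> nat \<Rightarrow> real) \<Rightarrow> nat vec \<Rightarrow> real vec" where
  "Y_obs N Y W = vec N (\<lambda>i. real (W $ i) * Y i 1 + (1 - real (W $ i)) * Y i 0)"


section \<open>Contrast approach\<close>

definition substitutes :: "nat vec pmf \<Rightarrow> nat \<Rightarrow> nat vec \<Rightarrow> nat vec set" where
  "substitutes d N w = {w' \<in> set_pmf d.
     real (card {i. i < N \<and> w' $ i = 1 \<and> w $ i = 1}) = real N / 4 \<and>
     real (card {i. i < N \<and> w' $ i = 1 \<and> w $ i = 0}) = real N / 4}"

definition contrast_vec :: "nat \<Rightarrow> nat vec \<Rightarrow> real vec" where
  "contrast_vec N w = vec N (\<lambda>i. if w $ i = 1 then 1 else - 1)"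

definition V_sub :: "nat vec pmf \<Rightarrow> nat \<Rightarrow> (nat \<Rightarrow> nat \<Rightarrow> real) \<Rightarrow> nat vec \<Rightarrow> real" where
  "V_sub d N Y W = 4 / (real N)\<^sup>2 *
     (\<Sum>w \<in> {w \<in> set_pmf d. W \<in> substitutes d N w}.
        pmf d w / pmf d W * (1 / real (card (substitutes d N w))) *
        (scalar_prod (contrast_vec N w) (Y_obs N Y W))\<^sup>2)"


section \<open>Neymanian decomposition\<close>

definition nonneg_definite :: "nat \<Rightarrow> real mat \<Rightarrow> bool" where
  "nonneg_definite N Q \<longleftrightarrow> Q \<in> carrier_mat N N \<and> transpose_mat Q = Q \<and>
     (\<forall>x \<in> carrier_vec N. 0 \<le> scalar_prod x (Q *\<^sub>v x))"

definition decomposition_matrix :: "nat \<Rightarrow> real mat \<Rightarrow> bool" where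
  "decomposition_matrix N Q \<longleftrightarrow> nonneg_definite N Q \<and>
     (\<forall>i<N. Q $$ (i, i) = 1 / (real N)\<^sup>2) \<and>
     (\<forall>i<N. (\<Sum>i'<N. Q $$ (i, i')) = 0)"

text \<open>
  \<open>decomp_coeff d N Q i i' w w'\<close> is the coefficient in braces of \<open>Y i w * Y i' w'\<close>; its
  denominators \<open>\<pi>\<^sub>i\<close> (for \<open>w = 1\<close>) and \<open>1 - \<pi>\<^sub>i\<close> (for \<open>w = 0\<close>) are selected by the arm.
\<close>

definition decomp_coeff ::
  "nat vec pmf \<Rightarrow> nat \<Rightarrow> real mat \<Rightarrow> nat \<Rightarrow> nat \<Rightarrow> nat \<Rightarrow> nat \<Rightarrow> real" where
  "decomp_coeff d N Q i i' w w' =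
     joint_prob d i i' w w' /
       ((real N)\<^sup>2 * (if w = 1 then incl_prob d i else 1 - incl_prob d i)
                 * (if w' = 1 then incl_prob d i' else 1 - incl_prob d i'))
     + Q $$ (i, i') - 1 / (real N)\<^sup>2"

text \<open>
  The expression \<open>V\<^sub>d(Q)\<close> with \<open>S i w\<close> in place of each square \<open>(Y i w)\<^sup>2\<close> and
  \<open>P i i' w w'\<close> in place of each product \<open>Y i w * Y i' w'\<close>. The variance component and its
  estimator are both instances of it.
\<close>

definition decomp_form ::
  "nat vec pmf \<Rightarrow> nat \<Rightarrow> real mat \<Rightarrow> (nat \<Rightarrow> nat \<Rightarrow> real) \<Rightarrow>
     (nat \<Rightarrow> nat \<Rightarrow> nat \<Rightarrow> nat \<Rightarrow> real) \<Rightarrow> real" where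
  "decomp_form d N Q S P =
     1 / (real N)\<^sup>2 *
       ((\<Sum>i<N. S i 1 / incl_prob d i) + (\<Sum>i<N. S i 0 / (1 - incl_prob d i)))
     + 2 * (\<Sum>i'<N. \<Sum>i<i'.
         P i i' 1 1 * decomp_coeff d N Q i i' 1 1 + P i i' 0 0 * decomp_coeff d N Q i i' 0 0)
     - 2 * (\<Sum>i'<N. \<Sum>i<i'.
         P i i' 1 0 * decomp_coeff d N Q i i' 1 0 + P i i' 0 1 * decomp_coeff d N Q i i' 0 1)"

definition V_decomp ::
  "nat vec pmf \<Rightarrow> nat \<Rightarrow> real mat \<Rightarrow> (nat \<Rightarrow> nat \<Rightarrow> real) \<Rightarrow> real" where
  "V_decomp d N Q Y =
     decomp_form d N Q (\<lambda>i w. (Y i w)\<^sup>2) (\<lambda>i i' w w'. Y i w * Y i' w')"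

(* The conditional omits the products with coefficient zero, for which joint_prob may vanish. *)
definition V_decomp_est ::
  "nat vec pmf \<Rightarrow> nat \<Rightarrow> real mat \<Rightarrow> (nat \<Rightarrow> nat \<Rightarrow> real) \<Rightarrow> nat vec \<Rightarrow> real" where
  "V_decomp_est d N Q Y W = decomp_form d N Q
     (\<lambda>i w. of_bool (W $ i = w) * (Y_obs N Y W $ i)\<^sup>2 / arm_prob d i w)
     (\<lambda>i i' w w'. if decomp_coeff d N Q i i' w w' = 0 then 0
        else of_bool (W $ i = w \<and> W $ i' = w') * (Y_obs N Y W $ i) * (Y_obs N Y W $ i')
               / joint_prob d i i' w w')"

end

theory Submission
  imports Defs
begin

text \<open>
  The four assignments are those in which the units of each pair at distance two
  receive opposite arms, independently across the two pairs. Hence the substitutes of an assignment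
  are the two assignments outside \<open>{w, 1 - w}\<close>. Their contrast vectors agree up to sign, so that
  the contrast estimator is one square divided by 4. The entries of \<open>Q\<close> cancel the coefficients of the
  products with joint probability zero, and the remaining terms expand the same square.
\<close>

lemma prob_pmf_of_set_eq_sum:
  assumes "finite S" "S \<noteq> {}"
  shows "measure_pmf.prob (pmf_of_set S) {x. P x} = (\<Sum>x\<in>S. of_bool (P x)) / real (card S)"
  using assms by (simp add: measure_pmf_of_set sum_of_bool_eq Int_def)

text \<open>As a sum of indicators, the counts in \<open>substitutes\<close> can be evaluated entry
  by entry for explicit vectors.\<close>

lemma card_less_eq_sum: "card {i. i < n \<and> P i} = (\<Sum>i<n::nat. of_bool (P i))"
  by (simp add: sum_of_bool_eq Int_def conj_commute)

lemma filter_insert: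
  "Set.filter P (insert a A) = (if P a then insert a (Set.filter P A) else Set.filter P A)"
  by auto

lemma less_4_cases: "i < (4::nat) \<longleftrightarrow> i = 0 \<or> i = 1 \<or> i = 2 \<or> i = 3"
  by auto

lemma sum_lessThan_4: "(\<Sum>i<4::nat. f i) = f 0 + f 1 + f 2 + f 3"
  for f :: "nat \<Rightarrow> 'a::comm_monoid_add"
  by (simp add: eval_nat_numeral add.assoc)

lemma sum_pairs_4:
  "(\<Sum>j<4::nat. \<Sum>i<j. f i j) = f 0 1 + (f 0 2 + f 1 2) + (f 0 3 + f 1 3 + f 2 3)"
  for f :: "nat \<Rightarrow> nat \<Rightarrow> 'a::comm_monoid_add"
  by (simp add: eval_nat_numeral add.assoc)

text \<open>Decides equality of explicit assignments. It needs them as \<open>vec_of_list\<close>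
  terms, so \<open>vec_of_list_Cons\<close> is disabled wherever it is used.\<close>

lemma vec_of_list_eq_iff: "vec_of_list xs = vec_of_list ys \<longleftrightarrow> xs = ys"
  by (metis list_vec)

lemma scalar_prod_4:
  "dim_vec y = 4 \<Longrightarrow> scalar_prod x y = x $ 0 * y $ 0 + x $ 1 * y $ 1 + x $ 2 * y $ 2 + x $ 3 * y $ 3"
  for x y :: "'a::comm_semiring_0 vec"
  by (simp add: scalar_prod_def atLeast0LessThan sum_lessThan_4)

text \<open>The quadratic form of an outer product is \<open>c\<close> times the square of the inner
  product of \<open>u\<close> and \<open>x\<close>.\<close>

lemma nonneg_definite_outer_product:
  fixes u :: "nat \<Rightarrow> real"
  assumes "0 \<le> c"
  shows "nonneg_definite n (mat n n (\<lambda>(i, j). c * (u i * u j)))"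
proof -
  have "0 \<le> scalar_prod x (mat n n (\<lambda>(i, j). c * (u i * u j)) *\<^sub>v x)"
    if "x \<in> carrier_vec n" for x
  proof -
    have "scalar_prod x (mat n n (\<lambda>(i, j). c * (u i * u j)) *\<^sub>v x)
        = (\<Sum>i<n. x $ i * (\<Sum>j<n. c * (u i * u j) * x $ j))"
      using that by (simp add: scalar_prod_def atLeast0LessThan)
    also have "\<dots> = c * (\<Sum>i<n. u i * x $ i)\<^sup>2"
      by (simp add: power2_eq_square sum_product sum_distrib_left algebra_simps)
    finally show ?thesis
      using assms by simp
  qed
  then show ?thesis
    by (auto simp: nonneg_definite_def intro!: eq_matI)
qed

definition paired_assignments :: "nat vec set" where
  "paired_assignments = {vec_of_list [1, 1, 0, 0], vec_of_list [0, 0, 1, 1],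
                         vec_of_list [1, 0, 0, 1], vec_of_list [0, 1, 1, 0]}"

lemma finite_paired_assignments: "finite paired_assignments"
  and paired_assignments_nonempty: "paired_assignments \<noteq> {}"
  by (simp_all add: paired_assignments_def)

lemma sum_paired_assignments:
  "sum f paired_assignments =
     f (vec_of_list [1, 1, 0, 0]) + f (vec_of_list [0, 0, 1, 1]) +
     f (vec_of_list [1, 0, 0, 1]) + f (vec_of_list [0, 1, 1, 0])"
  for f :: "nat vec \<Rightarrow> 'a::comm_monoid_add"
  by (simp add: paired_assignments_def vec_of_list_eq_iff add.assoc del: vec_of_list_Cons)

lemma card_paired_assignments: "card paired_assignments = 4"
  by (simp add: paired_assignments_def vec_of_list_eq_iff del: vec_of_list_Cons)

abbreviation "paired_design \<equiv> pmf_of_set paired_assignments"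

lemma prob_paired_design:
  "measure_pmf.prob paired_design {W. P W} =
     (of_bool (P (vec_of_list [1, 1, 0, 0])) + of_bool (P (vec_of_list [0, 0, 1, 1])) +
      of_bool (P (vec_of_list [1, 0, 0, 1])) + of_bool (P (vec_of_list [0, 1, 1, 0]))) / 4"
  by (simp only: prob_pmf_of_set_eq_sum finite_paired_assignments paired_assignments_nonempty
        not_False_eq_True sum_paired_assignments card_paired_assignments of_nat_numeral)

lemma arm_prob_paired_design:
  assumes "i < 4" "w \<le> 1"
  shows "arm_prob paired_design i w = 1 / 2"
  using assms unfolding less_4_cases
  by (auto simp: arm_prob_def prob_paired_design vec_of_list_index le_Suc_eq
           simp del: vec_of_list_Cons)

lemma incl_prob_paired_design: "i < 4 \<Longrightarrow> incl_prob paired_design i = 1 / 2"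
  using arm_prob_paired_design[of i 1] by (simp add: incl_prob_def arm_prob_def)

text \<open>Units 0 and 2 always receive opposite arms, and so do units 1 and 3; across these two
  pairs the arms are independent fair coins.\<close>

lemma joint_prob_paired_design:
  assumes "i < j" "j < 4" "w \<le> 1" "w' \<le> 1"
  shows "joint_prob paired_design i j w w' =
    (if j = i + 2 then (if w = w' then 0 else 1 / 2) else 1 / 4)"
proof -
  have "(i, j) \<in> {(0, 1), (0, 2), (0, 3), (1, 2), (1, 3), (2, 3)}"
    using assms by auto
  moreover have "w = 0 \<or> w = 1" "w' = 0 \<or> w' = 1"
    using assms by auto
  ultimately show ?thesis
    unfolding joint_prob_def prob_paired_design vec_of_list_index insert_iff empty_iff prod.inject
    by (elim disjE conjE FalseE) simp_all
qed

text \<open>Written as a multiple of an outer product so that non-negative definiteness is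
  immediate.\<close>

definition alternating_matrix :: "real mat" where
  "alternating_matrix = mat 4 4 (\<lambda>(i, j). 1 / 16 * ((- 1) ^ i * (- 1) ^ j))"

lemma decomposition_alternating_matrix: "decomposition_matrix 4 alternating_matrix"
proof -
  have "nonneg_definite 4 alternating_matrix"
    unfolding alternating_matrix_def by (rule nonneg_definite_outer_product) simp
  then show ?thesis
    by (simp add: decomposition_matrix_def alternating_matrix_def sum_lessThan_4)
qed

text \<open>With all inclusion probabilities 1/2 and N = 4, the first term is a quarter of the joint
  probability. At distance two the matrix entry 1/16 cancels 1/16, leaving 0 or 1/8; elsewhere 1/16
  - 1/16 - 1/16 remains.\<close>

lemma decomp_coeff_paired_design:
  assumes "i < j" "j < 4" "w \<le> 1" "w' \<le> 1"
  shows "decomp_coeff paired_design 4 alternating_matrix i j w w' =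
    (if j = i + 2 then (if w = w' then 0 else 1 / 8) else - 1 / 16)"
proof -
  have "(i, j) \<in> {(0, 1), (0, 2), (0, 3), (1, 2), (1, 3), (2, 3)}"
    using assms by auto
  then show ?thesis
    using assms
    by (auto simp: decomp_coeff_def joint_prob_paired_design incl_prob_paired_design
          alternating_matrix_def)
qed

text \<open>Whether the first two entries agree tells the two complementary pairs of assignments
  apart. An assignment shares two treated units with itself and none with its complement, but
  exactly one with each member of the other pair.\<close>

lemma substitutes_paired_design:
  assumes "w \<in> paired_assignments"
  shows "substitutes paired_design 4 w =
     (if w $ 0 = w $ 1
      then {vec_of_list [1, 0, 0, 1], vec_of_list [0, 1, 1, 0]}
      else {vec_of_list [1, 1, 0, 0], vec_of_list [0, 0, 1, 1]})"
proof -
  have "substitutes paired_design 4 w = Set.filter (\<lambda>w'.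
      (\<Sum>i<4. of_bool (w' $ i = 1 \<and> w $ i = 1)) = (1::nat) \<and>
      (\<Sum>i<4. of_bool (w' $ i = 1 \<and> w $ i = 0)) = (1::nat)) paired_assignments"
    by (auto simp: substitutes_def card_less_eq_sum finite_paired_assignments
          paired_assignments_nonempty)
  then show ?thesis
    using assms unfolding paired_assignments_def insert_iff empty_iff filter_insert
    by (elim disjE FalseE)
      (simp_all add: sum_lessThan_4 vec_of_list_index insert_commute del: vec_of_list_Cons)
qed

lemma mem_substitutes_paired_design:
  assumes "W \<in> paired_assignments" "w \<in> paired_assignments"
  shows "W \<in> substitutes paired_design 4 w \<longleftrightarrow> (W $ 0 = W $ 1) \<noteq> (w $ 0 = w $ 1)"
  using assms(1) unfolding substitutes_paired_design[OF assms(2)]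
  unfolding paired_assignments_def insert_iff empty_iff
  by (elim disjE FalseE)
    (simp_all add: vec_of_list_index vec_of_list_eq_iff del: vec_of_list_Cons)

lemma V_sub_paired_design:
  assumes "W \<in> paired_assignments"
  shows "V_sub paired_design 4 Y W = (let y = Y_obs 4 Y W in
    if W $ 0 = W $ 1 then (y $ 0 - y $ 1 - y $ 2 + y $ 3)\<^sup>2 / 4
    else (y $ 0 + y $ 1 - y $ 2 - y $ 3)\<^sup>2 / 4)"
proof -
  define y where "y = Y_obs 4 Y W"
  have "dim_vec y = 4"
    by (simp add: y_def Y_obs_def)
  have card: "card (substitutes paired_design 4 w) = 2" if "w \<in> paired_assignments" for w
    using that by (simp add: substitutes_paired_design vec_of_list_eq_iff del: vec_of_list_Cons)
  \<comment> \<open>The factor 4 / 16 gives 1/4, the ratio of probabilities is 1, and 1/2 is the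
    reciprocal of the number of substitutes.\<close>
  have "V_sub paired_design 4 Y W = 1 / 4 * (\<Sum>w \<in> {w \<in> paired_assignments.
      W \<in> substitutes paired_design 4 w}. 1 / 2 * (scalar_prod (contrast_vec 4 w) y)\<^sup>2)"
    using assms by (simp add: V_sub_def card finite_paired_assignments paired_assignments_nonempty
        card_paired_assignments flip: y_def)
  also have "\<dots> = 1 / 4 * (\<Sum>w \<in> paired_assignments. if W \<in> substitutes paired_design 4 w
      then 1 / 2 * (scalar_prod (contrast_vec 4 w) y)\<^sup>2 else 0)"
    by (simp only: sum.inter_filter finite_paired_assignments)
  also have "\<dots> = 1 / 4 * (\<Sum>w \<in> paired_assignments. if (W $ 0 = W $ 1) \<noteq> (w $ 0 = w $ 1)
      then 1 / 2 * (scalar_prod (contrast_vec 4 w) y)\<^sup>2 else 0)"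
    using assms by (intro arg_cong2[where f = "(*)"] sum.cong refl if_cong
        mem_substitutes_paired_design)
  \<comment> \<open>Two complementary \<open>w\<close> survive; their contrast vectors differ only
    in sign, so the two halves add up to one full square.\<close>
  also have "\<dots> = (if W $ 0 = W $ 1 then (y $ 0 - y $ 1 - y $ 2 + y $ 3)\<^sup>2 / 4
    else (y $ 0 + y $ 1 - y $ 2 - y $ 3)\<^sup>2 / 4)"
    unfolding sum_paired_assignments scalar_prod_4[OF \<open>dim_vec y = 4\<close>]
    by (simp add: contrast_vec_def vec_of_list_index power2_eq_square algebra_simps
        del: vec_of_list_Cons)
  finally show ?thesis
    by (simp add: y_def Let_def)
qed

text \<open>Each squared outcome gets weight 1/4. A product at distance two has opposite arms and
  gets -2 * (1/8) / (1/2) = -1/2. Any other product gets 2 * (-1/16) / (1/4) = -1/2 for equal arms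
  and 1/2 for opposite arms. These are the coefficients of the expanded square.\<close>

lemma V_decomp_est_paired_design:
  assumes "W \<in> paired_assignments"
  shows "V_decomp_est paired_design 4 alternating_matrix Y W = (let y = Y_obs 4 Y W in
    if W $ 0 = W $ 1 then (y $ 0 - y $ 1 - y $ 2 + y $ 3)\<^sup>2 / 4
    else (y $ 0 + y $ 1 - y $ 2 - y $ 3)\<^sup>2 / 4)"
proof -
  define y where "y = Y_obs 4 Y W"
  have "W = vec_of_list [1, 1, 0, 0] \<or> W = vec_of_list [0, 0, 1, 1] \<or>
        W = vec_of_list [1, 0, 0, 1] \<or> W = vec_of_list [0, 1, 1, 0]"
    using assms unfolding paired_assignments_def by blast
  then show ?thesis
    unfolding V_decomp_est_def decomp_form_def sum_pairs_4 sum_lessThan_4 y_def[symmetric] Let_def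
    by (elim disjE)
      (simp_all add: decomp_coeff_paired_design joint_prob_paired_design incl_prob_paired_design
        arm_prob_paired_design vec_of_list_index power2_eq_square algebra_simps
        del: vec_of_list_Cons One_nat_def)
qed

theorem proposition4p3:
  fixes Y :: "nat \<Rightarrow> nat \<Rightarrow> real" and d :: "nat vec pmf" and Q :: "real mat"
  assumes "d = pmf_of_set {vec_of_list [1, 1, 0, 0], vec_of_list [0, 0, 1, 1],
                           vec_of_list [1, 0, 0, 1], vec_of_list [0, 1, 1, 0]}"
    and "Q = (1 / 16) \<cdot>\<^sub>m mat_of_rows_list 4 [[ 1, - 1,   1, - 1],
                                          [- 1,   1, - 1,   1],
                                          [ 1, - 1,   1, - 1],
                                          [- 1,   1, - 1,   1]]"
  shows "decomposition_matrix 4 Q \<and>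
         (\<forall>W \<in> set_pmf d. V_sub d 4 Y W = V_decomp_est d 4 Q Y W)"
proof -
  have d: "d = paired_design"
    by (simp only: assms(1) paired_assignments_def)
  have "Q = alternating_matrix"
    by (rule eq_matI) (auto simp: assms(2) alternating_matrix_def mat_of_rows_list_def less_4_cases)
  then show ?thesis
    using decomposition_alternating_matrix
    by (simp add: d V_sub_paired_design V_decomp_est_paired_design
          finite_paired_assignments paired_assignments_nonempty)
qed

end
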